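(* For any positive integer $r$, there exist arbitrarily large integers $N$ such that $\{1,\ldots,N\}$ has a partition $\{1,\ldots,N\}=A_1\cup\cdots\cup A_r$ with \[\max\{R_2(A_i):1\leq i\leq r\}\leq 2(r-1)!\,N^{1/r}\] and \[\max\{C(A_i):1\leq i\leq r\}\leq r!\,N^{1/r}.\]
   Context: A finite increasing sequence $a_1<\cdots<a_n$ is strictly convex if the sequence of first differences $a_{i+1}-a_i$ is strictly monotone; $C(B)$ denotes the length of the longest strictly convex sequence contained in $B$. For $L\geq 1$, a finite increasing sequence of real numbers $a_1<\cdots<a_n$ is called $L$-regular if there is a positive real number $X$ such that $X\leq a_{i+1}-a_i\leq LX$ for all $i=1,\ldots,n-1$. For a set $B$ of real numbers, $R_L(B)=\max\{|B'|:B'\subseteq B,\ B'\text{ is }L\text{-regular}\}$. *)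

theory Defs
  imports Complex_Main "HOL-Library.Disjoint_Sets"
begin

definition differences :: "real list \<Rightarrow> real list" where
  "differences xs = map (\<lambda>i. xs ! Suc i - xs ! i) [0..<length xs - 1]"

(* Both directions of monotonicity of the differences are allowed, so "concave" sequences count
   as strictly convex too; sequences with at most two terms are strictly convex. *)
definition strictly_convex :: "real list \<Rightarrow> bool" where
  "strictly_convex xs \<longleftrightarrow> sorted_wrt (<) xs \<and>
     (sorted_wrt (<) (differences xs) \<or> sorted_wrt (>) (differences xs))"

definition L_regular :: "real \<Rightarrow> real list \<Rightarrow> bool" where
  "L_regular L xs \<longleftrightarrow> sorted_wrt (<) xs \<and>
     (\<exists>X>0. \<forall>d\<in>set (differences xs). X \<le> d \<and> d \<le> L * X)"

(* The two maxima below are meaningful for finite B, the only case needed: Max is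
   unspecified on infinite sets. *)
definition C :: "real set \<Rightarrow> nat" where
  "C B = Max {length xs | xs. set xs \<subseteq> B \<and> strictly_convex xs}"

definition R :: "real \<Rightarrow> real set \<Rightarrow> nat" where
  "R L B = Max {card B' | B'. B' \<subseteq> B \<and> finite B' \<and> L_regular L (sorted_list_of_set B')}"

end

theory Submission
  imports Defs
begin

text \<open>
  Take \<open>N = n ^ r\<close> and colour recursively: at level \<open>r + 1\<close>, cut \<open>{0..<n ^ (r + 1)}\<close> into \<open>n\<close> blocks of
  length \<open>D = n ^ r\<close>; block \<open>b\<close> omits the colour \<open>b mod (r + 1)\<close> and is coloured with the other \<open>r\<close>
  colours as at level \<open>r\<close>.  A monochromatic sequence without a step longer than \<open>D\<close> cannot cross a
  block that omits its colour, so it stays within \<open>r\<close> consecutive blocks.  If a 2-regular sequence has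
  a step longer than \<open>D\<close>, then all its steps are longer than \<open>D / 2\<close> and it has at most \<open>2 * n\<close> terms.
  In a strictly convex sequence the steps longer than \<open>D\<close> are consecutive, at one end of the sequence,
  and there are fewer than \<open>n\<close> of them.  Hence \<open>R\<close> is at most multiplied by \<open>r\<close> from level \<open>r\<close> to level
  \<open>r + 1\<close> (if it is at least \<open>2 * n\<close>), and \<open>C\<close> is at most multiplied by \<open>r\<close> and increased by \<open>n\<close>.
\<close>

section \<open>Difference lists under cutting and shifting\<close>

lemma length_differences [simp]: "length (differences xs) = length xs - 1"
  by (simp add: differences_def)

lemma nth_differences: "Suc i < length xs \<Longrightarrow> differences xs ! i = xs ! Suc i - xs ! i"
  by (simp add: differences_def less_diff_conv)

lemma differences_take: "differences (take m xs) = take (m - 1) (differences xs)"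
  by (rule nth_equalityI) (auto simp: nth_differences less_diff_conv)

lemma differences_drop: "differences (drop m xs) = drop m (differences xs)"
  by (rule nth_equalityI) (auto simp: nth_differences)

lemma differences_translate: "differences (map (\<lambda>x. x + t) xs) = differences xs"
  by (rule nth_equalityI) (auto simp: nth_differences)

text \<open>Telescoping. Inside an interval of known length, this turns a lower bound on the steps
  into an upper bound on their number.\<close>

lemma last_minus_first_ge:
  assumes "\<And>l. i \<le> l \<Longrightarrow> l < j \<Longrightarrow> d \<le> xs ! Suc l - xs ! l" "i \<le> j"
  shows "real (j - i) * d \<le> xs ! j - (xs ! i :: real)"
  using assms(2,1)
proof (induction j rule: dec_induct)
  case (step j)
  have "real (j - i) * d \<le> xs ! j - xs ! i" "d \<le> xs ! Suc j - xs ! j"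
    using step by auto
  then show ?case
    using step(1) by (simp add: Suc_diff_le algebra_simps)
qed auto

section \<open>Length bounds for hereditary list properties\<close>

text \<open>Collects what the block arguments require of both regularity and convexity, so that
  these arguments are carried out once for a general \<open>P\<close>.\<close>

definition hereditary :: "(real list \<Rightarrow> bool) \<Rightarrow> bool" where
  "hereditary P \<longleftrightarrow> (\<forall>xs. P xs \<longrightarrow> sorted_wrt (<) xs \<and>
     (\<forall>m. P (take m xs) \<and> P (drop m xs)) \<and> (\<forall>t. P (map (\<lambda>x. x + t) xs)))"

text \<open>Stands in for upper bounds on \<open>R\<close> and \<open>C\<close>, so that no maximum
  has to be handled before the very end.\<close>

definition length_bounded :: "(real list \<Rightarrow> bool) \<Rightarrow> nat \<Rightarrow> real set \<Rightarrow> bool" where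
  "length_bounded P k S \<longleftrightarrow> (\<forall>xs. P xs \<longrightarrow> set xs \<subseteq> S \<longrightarrow> length xs \<le> k)"

lemma length_boundedD: "length_bounded P k S \<Longrightarrow> P xs \<Longrightarrow> set xs \<subseteq> S \<Longrightarrow> length xs \<le> k"
  by (auto simp: length_bounded_def)

lemma hereditary_L_regular: "hereditary (L_regular L)"
  unfolding hereditary_def L_regular_def differences_take differences_drop differences_translate
  by (auto simp: sorted_wrt_map
      dest: in_set_takeD in_set_dropD)

lemma hereditary_strictly_convex: "hereditary strictly_convex"
  unfolding hereditary_def strictly_convex_def differences_take differences_drop differences_translate
  by (auto simp: sorted_wrt_map)

lemma length_bounded_translate:
  assumes "hereditary P" "length_bounded P k S"
  shows "length_bounded P k ((\<lambda>x. x + t) ` S)"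
  unfolding length_bounded_def
proof (intro allI impI)
  fix xs assume xs: "P xs" "set xs \<subseteq> (\<lambda>x. x + t) ` S"
  then have "P (map (\<lambda>x. x + - t) xs)" "set (map (\<lambda>x. x + - t) xs) \<subseteq> S"
    using assms(1) unfolding hereditary_def by blast (use xs in auto)
  then show "length xs \<le> k"
    using assms(2) by (metis length_boundedD length_map)
qed

lemma length_bounded_card:
  assumes "hereditary P" "finite S" "card S \<le> k"
  shows "length_bounded P k S"
  unfolding length_bounded_def
proof (intro allI impI)
  fix xs assume xs: "P xs" "set xs \<subseteq> S"
  then have "distinct xs"
    using assms(1) unfolding hereditary_def by (meson strict_sorted_iff)
  then show "length xs \<le> k"
    using xs assms by (metis card_mono distinct_card le_trans)
qed

text \<open>Induction on \<open>m\<close>: a sorted list splits at the last block boundary into a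
  prefix inside the first \<open>m\<close> blocks and a suffix inside one block, and both pieces
  inherit \<open>P\<close>.\<close>

lemma length_bounded_blocks:
  assumes P: "hereditary P"
    and k: "\<And>b :: nat. length_bounded P k (S \<inter> {real b * D..<real (b + 1) * D})"
  shows "length_bounded P (m * k) (S \<inter> {real b * D..<real (b + m) * D})"
proof (induction m)
  case 0
  then show ?case by (auto simp: length_bounded_def)
next
  case (Suc m)
  show ?case
    unfolding length_bounded_def
  proof (intro allI impI)
    fix xs assume xs: "P xs" "set xs \<subseteq> S \<inter> {real b * D..<real (b + Suc m) * D}"
    define c where "c = real (b + m) * D"
    define l where "l = length (takeWhile (\<lambda>x. x < c) xs)"
    have srt: "sorted xs"
      using P xs(1) unfolding hereditary_def by (blast intro: strict_sorted_imp_sorted)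
    have t: "take l xs = takeWhile (\<lambda>x. x < c) xs" and d: "drop l xs = dropWhile (\<lambda>x. x < c) xs"
      unfolding l_def by (rule takeWhile_eq_take[symmetric], rule dropWhile_eq_drop[symmetric])
    have "P (take l xs)" "P (drop l xs)"
      using P xs(1) unfolding hereditary_def by auto
    moreover have "set (take l xs) \<subseteq> S \<inter> {real b * D..<c}"
      using xs(2) unfolding t by (fastforce dest: set_takeWhileD)
    moreover have "c \<le> x" if x: "x \<in> set (drop l xs)" for x
    proof -
      have ne: "dropWhile (\<lambda>x. x < c) xs \<noteq> []"
        using x unfolding d by (metis empty_iff list.set(1))
      then have "c \<le> drop l xs ! 0"
        unfolding d hd_conv_nth[OF ne, symmetric] using hd_dropWhile[OF ne] by (simp only: not_less)
      moreover obtain q where "q < length (drop l xs)" "x = drop l xs ! q"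
        using x by (metis in_set_conv_nth)
      moreover have "sorted (drop l xs)"
        using srt by (rule sorted_wrt_drop)
      ultimately show ?thesis
        using sorted_nth_mono[of "drop l xs" 0 q] by (blast intro: order_trans)
    qed
    then have "set (drop l xs) \<subseteq> S \<inter> {real (b + m) * D..<real (b + m + 1) * D}"
      using xs(2) by (auto simp: c_def dest: in_set_dropD)
    ultimately have "length (take l xs) \<le> m * k" "length (drop l xs) \<le> k"
      using Suc k[of "b + m"] unfolding c_def by (auto dest: length_boundedD)
    moreover have "length xs = length (take l xs) + length (drop l xs)"
      by (metis append_take_drop_id length_append)
    ultimately show "length xs \<le> Suc m * k"
      unfolding mult_Suc by linarith
  qed
qed

section \<open>One level of the recursion: sets that periodically omit blocks\<close>

text \<open>The point of the period \<open>Suc r\<close>: for \<open>i < Suc r\<close>, any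
  \<open>Suc r\<close> consecutive blocks include one that misses \<open>S\<close>.\<close>

definition omits_blocks :: "nat \<Rightarrow> nat \<Rightarrow> real \<Rightarrow> real set \<Rightarrow> bool" where
  "omits_blocks r i D S \<longleftrightarrow>
     (\<forall>b :: nat. b mod Suc r = i \<longrightarrow> S \<inter> {real b * D..<real (b + 1) * D} = {})"

text \<open>A step of length at most \<open>D\<close> cannot jump over a half-open block of length
  \<open>D\<close>. One of the \<open>r + 1\<close> blocks starting with that of the first term is
  omitted, so the list is trapped in the at most \<open>r\<close> blocks before it.\<close>

lemma short_steps_length_le:
  assumes P: "hereditary P"
    and k: "\<And>b :: nat. length_bounded P k (S \<inter> {real b * D..<real (b + 1) * D})"
    and S: "omits_blocks r i D S" "S \<subseteq> {0..}" and D: "D > 0" and i: "i < Suc r"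
    and xs: "P xs" "set xs \<subseteq> S"
    and short: "\<And>j. Suc j < length xs \<Longrightarrow> xs ! Suc j - xs ! j \<le> D"
  shows "length xs \<le> r * k"
proof (cases "xs = []")
  case False
  \<comment> \<open>Index of the block that contains the first term; \<open>nat\<close> loses
    nothing because \<open>S\<close> is nonnegative.\<close>
  define b where "b = nat \<lfloor>xs ! 0 / D\<rfloor>"
  have "xs ! 0 \<in> S"
    using False xs by auto
  then have "xs ! 0 \<ge> 0"
    using S by auto
  then have "real b = of_int \<lfloor>xs ! 0 / D\<rfloor>"
    using D by (simp add: b_def)
  then have b: "real b * D \<le> xs ! 0" "xs ! 0 < real (b + 1) * D"
    using floor_divide_lower[OF D, of "xs ! 0"] floor_divide_upper[OF D, of "xs ! 0"]
    by (simp_all add: add.commute)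
  obtain m where m: "b \<le> m" "m \<le> b + r" "m mod Suc r = i"
  proof
    \<comment> \<open>The residue of \<open>i - b\<close> modulo \<open>Suc r\<close>; adding
      \<open>Suc r\<close> keeps the natural subtraction from truncating.\<close>
    define q where "q = (i + Suc r - b mod Suc r) mod Suc r"
    show "b \<le> b + q" by simp
    show "b + q \<le> b + r"
      unfolding q_def by (simp add: less_Suc_eq_le[symmetric] del: mod_Suc_eq)
    have "b mod Suc r < Suc r" by simp
    have "(b + q) mod Suc r = (b mod Suc r + (i + Suc r - b mod Suc r)) mod Suc r"
      unfolding q_def by (simp only: mod_add_left_eq mod_add_right_eq)
    also have "b mod Suc r + (i + Suc r - b mod Suc r) = i + Suc r"
      using \<open>b mod Suc r < Suc r\<close> by linarith
    finally show "(b + q) mod Suc r = i"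
      using i by (simp only: mod_add_self2 mod_less)
  qed
  have gap: "x \<notin> {real m * D..<real (m + 1) * D}" if "x \<in> S" for x
    using S(1) m(3) that unfolding omits_blocks_def by blast
  \<comment> \<open>A term below \<open>m * D\<close> is followed by one below
    \<open>(m + 1) * D\<close>, and block \<open>m\<close> contains no point of \<open>S\<close>, so
    the next term is again below \<open>m * D\<close>.\<close>
  have upper: "xs ! j < real m * D" if "j < length xs" for j
    using that
  proof (induction j)
    case 0
    have "real (b + 1) * D \<le> real (m + 1) * D"
      using m D by simp
    then have "xs ! 0 < real (m + 1) * D"
      using b by linarith
    then show ?case
      using gap[OF \<open>xs ! 0 \<in> S\<close>] by auto
  next
    case (Suc j)
    then have "xs ! Suc j < real m * D + D"
      using short[of j] by simp
    moreover have "xs ! Suc j \<in> S"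
      using Suc xs by auto
    ultimately show ?case
      using gap[of "xs ! Suc j"] by (auto simp: algebra_simps)
  qed
  have "sorted_wrt (<) xs"
    using P xs(1) unfolding hereditary_def by blast
  then have lower: "xs ! 0 \<le> xs ! j" if "j < length xs" for j
    using that by (cases j) (auto simp: sorted_wrt_iff_nth_less less_imp_le)
  have "real m * D \<le> real (b + r) * D"
    using m D by simp
  then have "set xs \<subseteq> S \<inter> {real b * D..<real (b + r) * D}"
    using xs(2) b(1) lower upper by (fastforce simp: in_set_conv_nth)
  then show ?thesis
    using length_bounded_blocks[OF P k] xs(1) length_boundedD by blast
qed auto

lemma L_regular_length_bounded:
  assumes k: "\<And>b :: nat. length_bounded (L_regular 2) k (S \<inter> {real b * D..<real (b + 1) * D})"
    and S: "omits_blocks r i D S" "S \<subseteq> {0..<real n * D}" and D: "D > 0" and i: "i < Suc r"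
  shows "length_bounded (L_regular 2) (max (r * k) (2 * n)) S"
  unfolding length_bounded_def
proof (intro allI impI)
  fix xs assume xs: "L_regular 2 xs" "set xs \<subseteq> S"
  show "length xs \<le> max (r * k) (2 * n)"
  proof (cases "\<exists>j. Suc j < length xs \<and> xs ! Suc j - xs ! j > D")
    case False
    then have "length xs \<le> r * k"
      using short_steps_length_le[OF hereditary_L_regular k S(1) _ D i xs] S(2) by force
    then show ?thesis by simp
  next
    case True
    then obtain j where j: "Suc j < length xs" "xs ! Suc j - xs ! j > D" by blast
    obtain X where X: "\<forall>d\<in>set (differences xs). X \<le> d \<and> d \<le> 2 * X"
      using xs(1) unfolding L_regular_def by blast
    have steps: "X \<le> xs ! Suc l - xs ! l \<and> xs ! Suc l - xs ! l \<le> 2 * X" if "Suc l < length xs" for l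
    proof -
      have "differences xs ! l \<in> set (differences xs)"
        using that by simp
      then show ?thesis
        using X nth_differences[OF that] by metis
    qed
    have "D / 2 \<le> X"
      using steps[OF j(1)] j(2) by simp
    have "real (length xs - 1 - 0) * (D / 2) \<le> xs ! (length xs - 1) - xs ! 0"
    proof (rule last_minus_first_ge)
      fix l assume "l < length xs - 1"
      then show "D / 2 \<le> xs ! Suc l - xs ! l"
        using steps[of l] \<open>D / 2 \<le> X\<close> by (simp add: less_diff_conv)
    qed simp
    moreover have "xs \<noteq> []"
      using j by auto
    then have "xs ! (length xs - 1) \<in> S" "xs ! 0 \<in> S"
      using xs(2) by auto
    then have "xs ! (length xs - 1) < real n * D" "0 \<le> xs ! 0"
      using S(2) by auto
    ultimately have "real (length xs - 1) * (D / 2) < real n * D"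
      by simp
    then have "real (length xs - 1) * D < real (2 * n) * D"
      by simp
    \<comment> \<open>Fewer than \<open>2 * n\<close> steps, hence at most \<open>2 * n\<close>
      terms.\<close>
    then have "length xs - 1 < 2 * n"
      using D by (simp only: mult_less_cancel_right_pos of_nat_less_iff)
    then show ?thesis by simp
  qed
qed

lemma strictly_convex_length_bounded:
  assumes k: "\<And>b :: nat. length_bounded strictly_convex k (S \<inter> {real b * D..<real (b + 1) * D})"
    and S: "omits_blocks r i D S" "S \<subseteq> {0..<real n * D}" and D: "D > 0" and i: "i < Suc r"
  shows "length_bounded strictly_convex (r * k + n) S"
  unfolding length_bounded_def
proof (intro allI impI)
  fix xs assume xs: "strictly_convex xs" "set xs \<subseteq> S"
  define long where "long j \<longleftrightarrow> Suc j < length xs \<and> xs ! Suc j - xs ! j > D" for j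
  have short: "length ys \<le> r * k"
    if "strictly_convex ys" "set ys \<subseteq> S" "\<And>j. Suc j < length ys \<Longrightarrow> ys ! Suc j - ys ! j \<le> D" for ys
    using short_steps_length_le[OF hereditary_strictly_convex k S(1) _ D i that(1,2)] that(3) S(2)
    by force
  \<comment> \<open>A run of \<open>b - a\<close> long steps spans at least
    \<open>(b - a) * D\<close>, while two points of \<open>S\<close> differ by less than
    \<open>n * D\<close>.\<close>
  have few_long: "b - a < n" if "a \<le> b" "b < length xs" "\<And>l. a \<le> l \<Longrightarrow> l < b \<Longrightarrow> long l" for a b
  proof -
    have "real (b - a) * D \<le> xs ! b - xs ! a"
      by (rule last_minus_first_ge) (use that in \<open>auto simp: long_def less_imp_le\<close>)
    moreover have "xs ! b \<in> S" "xs ! a \<in> S"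
      using that xs(2) by auto
    then have "xs ! b < real n * D" "0 \<le> xs ! a"
      using S(2) by auto
    ultimately have "real (b - a) * D < real n * D"
      by linarith
    then show ?thesis
      using D by (simp only: mult_less_cancel_right_pos of_nat_less_iff)
  qed
  have part: "strictly_convex (take m xs)" "strictly_convex (drop m xs)"
    "set (take m xs) \<subseteq> S" "set (drop m xs) \<subseteq> S" for m
    using xs hereditary_strictly_convex unfolding hereditary_def
    by (auto dest: in_set_takeD in_set_dropD)
  show "length xs \<le> r * k + n"
  proof (cases "\<exists>j. long j")
    case False
    then show ?thesis
      using short[OF xs] by (force simp: long_def)
  next
    case True
    from xs(1) consider (incr) "sorted_wrt (<) (differences xs)" | (decr) "sorted_wrt (>) (differences xs)"
      unfolding strictly_convex_def by blast
    then show ?thesis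
    proof cases
      case incr
      \<comment> \<open>Differences increase, so every step from the first long one onwards is long.
        The terms up to index \<open>j\<close> are joined by short steps only, and fewer than
        \<open>n\<close> terms follow.\<close>
      define j where "j = (LEAST j. long j)"
      have j: "long j" "\<And>l. l < j \<Longrightarrow> \<not> long l"
        using True unfolding j_def by (auto intro: LeastI dest: not_less_Least)
      have "length (take (Suc j) xs) \<le> r * k"
        by (rule short[OF part(1,3)]) (use j(2) in \<open>force simp: long_def\<close>)
      moreover have "long l" if "j \<le> l" "l < length xs - 1" for l
      proof (cases "j = l")
        case False
        then have "differences xs ! j < differences xs ! l"
          using incr that by (simp add: sorted_wrt_iff_nth_less)
        then show ?thesis
          using j(1) that by (simp add: long_def nth_differences)
      qed (use j in simp)
      then have "length xs - 1 - j < n"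
        using j(1) by (intro few_long) (auto simp: long_def)
      ultimately show ?thesis
        using j(1) by (simp add: long_def)
    next
      case decr
      \<comment> \<open>The mirror image: every step up to the last long one is long, and the terms
        after index \<open>j\<close> are joined by short steps only.\<close>
      define j where "j = (GREATEST j. long j)"
      have bound: "\<And>l. long l \<Longrightarrow> l \<le> length xs"
        by (simp add: long_def)
      have j: "long j"
        unfolding j_def using True bound by (metis GreatestI_ex_nat)
      have j': "\<not> long l" if "l > j" for l
        using that bound Greatest_le_nat[of long l "length xs"] unfolding j_def by auto
      have "length (drop (Suc j) xs) \<le> r * k"
      proof (rule short[OF part(2,4)])
        fix l assume "Suc l < length (drop (Suc j) xs)"
        then show "drop (Suc j) xs ! Suc l - drop (Suc j) xs ! l \<le> D"
          using j'[of "Suc j + l"] by (simp add: long_def not_less less_diff_conv algebra_simps)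
      qed
      moreover have "long l" if "l < Suc j" for l
      proof (cases "j = l")
        case False
        then have "differences xs ! j < differences xs ! l"
          using decr that j by (auto simp: sorted_wrt_iff_nth_less long_def)
        then show ?thesis
          using j that by (simp add: long_def nth_differences)
      qed (use j in simp)
      then have "Suc j - 0 < n"
        using j by (intro few_long) (auto simp: long_def)
      ultimately show ?thesis
        using j by (simp add: long_def)
    qed
  qed
qed

section \<open>The recursive colouring\<close>

text \<open>The increasing enumeration of the naturals other than \<open>m\<close>; it renames the
  colours of the previous level to those allowed in a block that omits \<open>m\<close>.\<close>

definition skip :: "nat \<Rightarrow> nat \<Rightarrow> nat" where
  "skip m c = (if c < m then c else Suc c)"

lemma skip_neq: "skip m c \<noteq> m"
  by (simp add: skip_def)

lemma skip_inj: "skip m c = skip m d \<longleftrightarrow> c = d"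
  by (auto simp: skip_def)

lemma skip_less: "c < r \<Longrightarrow> skip m c < Suc r"
  by (simp add: skip_def)

lemma skip_surj:
  assumes "i < Suc r" "m < Suc r" "i \<noteq> m"
  shows "\<exists>c<r. skip m c = i"
  by (rule exI[of _ "if i < m then i else i - 1"]) (use assms in \<open>auto simp: skip_def\<close>)

text \<open>Positions start at 0 so that \<open>div\<close> and \<open>mod\<close> give the block
  and the place within it; the shift to \<open>{1..N}\<close> comes at the end.\<close>

definition colour_class :: "nat \<Rightarrow> (nat \<Rightarrow> nat) \<Rightarrow> nat \<Rightarrow> real set" where
  "colour_class N f i = real ` {p. p < N \<and> f p = i}"

text \<open>Induction on \<open>r\<close>, with \<open>Suc r\<close> colours. With one colour, the
  bounds follow from the cardinality \<open>n\<close> alone. Nonemptiness is carried along because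
  every part of the final partition has to be nonempty.\<close>

lemma ex_colouring:
  assumes "n \<ge> 2"
  shows "\<exists>f. (\<forall>p<n ^ Suc r. f p < Suc r) \<and>
    (\<forall>i<Suc r. colour_class (n ^ Suc r) f i \<noteq> {} \<and>
       length_bounded (L_regular 2) (2 * fact r * n) (colour_class (n ^ Suc r) f i) \<and>
       length_bounded strictly_convex (fact (Suc r) * n) (colour_class (n ^ Suc r) f i))"
proof (induction r)
  case 0
  have *: "colour_class n (\<lambda>_. 0) 0 = real ` {..<n}"
    by (auto simp: colour_class_def)
  have "card (real ` {..<n}) = n"
    by (simp add: card_image)
  then show ?case
    using assms by (intro exI[of _ "\<lambda>_. 0"])
      (auto simp: * lessThan_empty_iff intro!: length_bounded_card hereditary_L_regular hereditary_strictly_convex)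
next
  case (Suc r)
  define s where "s = Suc r"
  define D where "D = n ^ s"
  have D: "D > 0"
    using assms by (simp add: D_def)
  from Suc obtain f where f: "\<And>p. p < D \<Longrightarrow> f p < s"
    and ne: "\<And>i. i < s \<Longrightarrow> colour_class D f i \<noteq> {}"
    and reg: "\<And>i. i < s \<Longrightarrow> length_bounded (L_regular 2) (2 * fact r * n) (colour_class D f i)"
    and conv: "\<And>i. i < s \<Longrightarrow> length_bounded strictly_convex (fact s * n) (colour_class D f i)"
    unfolding s_def[symmetric] D_def[symmetric] by blast
  \<comment> \<open>\<open>p div D\<close> is the block, which determines the omitted colour;
    \<open>p mod D\<close> is the position at which the previous colouring \<open>f\<close> is
    read.\<close>
  define g where "g p = skip ((p div D) mod Suc s) (f (p mod D))" for p
  define S where "S = colour_class (n * D) g"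
  have block: "\<exists>p. x = real (b * D + p) \<and> p < D \<and> b < n \<and> skip (b mod Suc s) (f p) = i"
    if x: "x \<in> S i \<inter> {real b * real D..<real (b + 1) * real D}" for x b i
  proof -
    obtain p where p: "x = real p" "p < n * D" "g p = i"
      using x by (auto simp: S_def colour_class_def)
    have "real (b * D) \<le> real p" "real p < real ((b + 1) * D)"
      using x p by (auto simp: algebra_simps)
    then have "b * D \<le> p" "p < (b + 1) * D"
      by (simp_all only: of_nat_le_iff of_nat_less_iff)
    then have "p div D = b"
      by (intro div_nat_eqI) (auto simp: algebra_simps)
    moreover have "p div D < n"
      using p(2) by (simp add: less_mult_imp_div_less)
    moreover have "p = b * D + p mod D"
      using \<open>p div D = b\<close> div_mult_mod_eq[of p D] by simp
    ultimately show ?thesis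
      using p D unfolding g_def by (intro exI[of _ "p mod D"]) auto
  qed
  have omits: "omits_blocks s i (real D) (S i)" for i
    unfolding omits_blocks_def using block skip_neq by blast
  have sub: "S i \<subseteq> {0..<real n * real D}" for i
    by (auto simp: S_def colour_class_def simp flip: of_nat_mult)
  \<comment> \<open>Since \<open>skip\<close> is injective, one colour of \<open>g\<close> within a
    block comes from a single colour of \<open>f\<close>, so the bounds for \<open>f\<close> carry
    over by translation.\<close>
  have translate: "S i \<inter> {real b * real D..<real (b + 1) * real D} = {} \<or>
    (\<exists>c<s. S i \<inter> {real b * real D..<real (b + 1) * real D} \<subseteq> (\<lambda>x. x + real (b * D)) ` colour_class D f c)" for i b
  proof (cases "S i \<inter> {real b * real D..<real (b + 1) * real D} = {}")
    case False
    then obtain p where p: "p < D" "skip (b mod Suc s) (f p) = i"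
      using block by blast
    have "x \<in> (\<lambda>x. x + real (b * D)) ` colour_class D f (f p)"
      if x: "x \<in> S i \<inter> {real b * real D..<real (b + 1) * real D}" for x
    proof -
      obtain q where "x = real (b * D + q)" "q < D" "skip (b mod Suc s) (f q) = i"
        using block[OF x] by blast
      then show ?thesis
        using p by (auto simp: colour_class_def skip_inj image_iff)
    qed
    then show ?thesis
      using f p(1) by blast
  qed simp
  have blocks_bounded: "length_bounded P k (S i \<inter> {real b * real D..<real (b + 1) * real D})"
    if P: "hereditary P" and k: "\<And>c. c < s \<Longrightarrow> length_bounded P k (colour_class D f c)" for P k i b
    using translate[of i b]
  proof
    assume "\<exists>c<s. S i \<inter> {real b * real D..<real (b + 1) * real D} \<subseteq> (\<lambda>x. x + real (b * D)) ` colour_class D f c"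
    then obtain c where "c < s"
      and c: "S i \<inter> {real b * real D..<real (b + 1) * real D} \<subseteq> (\<lambda>x. x + real (b * D)) ` colour_class D f c"
      by blast
    show ?thesis
      using length_bounded_translate[OF P k[OF \<open>c < s\<close>]] c
      unfolding length_bounded_def by (meson subset_trans)
  qed (simp add: length_bounded_def)
  have "g p < Suc s" if "p < n * D" for p
    unfolding g_def using f D by (intro skip_less) simp
  moreover have "S i \<noteq> {}" if i: "i < Suc s" for i
  proof -
    \<comment> \<open>A block that does not omit colour \<open>i\<close>: block 0 omits only colour
      0, and for that colour block 1 exists because \<open>n \<ge> 2\<close>.\<close>
    define b where "b = (if i = 0 then 1 else 0 :: nat)"
    have b: "b < n" "b mod Suc s \<noteq> i"
      using assms by (auto simp: b_def s_def)
    then obtain c where c: "c < s" "skip (b mod Suc s) c = i"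
      using skip_surj[OF i, of "b mod Suc s"] by auto
    then obtain p where p: "p < D" "f p = c"
      using ne[of c] by (auto simp: colour_class_def)
    have "g (b * D + p) = i"
      using p c by (simp add: g_def)
    moreover have "b * D + p < n * D"
    proof -
      have "b * D + p < Suc b * D" using p by simp
      also have "\<dots> \<le> n * D" using b by (intro mult_le_mono1) simp
      finally show ?thesis .
    qed
    ultimately show ?thesis
      by (auto simp: S_def colour_class_def)
  qed
  moreover have "length_bounded (L_regular 2) (2 * fact s * n) (S i)" if i: "i < Suc s" for i
  proof -
    have "s * (2 * fact r * n) = 2 * fact s * n"
      by (simp add: s_def algebra_simps)
    moreover have "2 * n \<le> 2 * fact s * n"
      using fact_ge_1[of s, where 'a = nat] by simp
    ultimately have "max (s * (2 * fact r * n)) (2 * n) = 2 * fact s * n"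
      by (simp only: max_absorb1)
    then show ?thesis
      using L_regular_length_bounded[OF blocks_bounded[OF hereditary_L_regular reg] omits sub _ i] D by simp
  qed
  moreover have "length_bounded strictly_convex (fact (Suc s) * n) (S i)" if i: "i < Suc s" for i
  proof -
    \<comment> \<open>\<open>fact (Suc s) = s * fact s + fact s\<close>, and the last summand, being
      at least 1, absorbs the additional \<open>n\<close>.\<close>
    have "s * (fact s * n) + n \<le> fact (Suc s) * n"
      by (simp add: algebra_simps)
    moreover have "length_bounded strictly_convex (s * (fact s * n) + n) (S i)"
      using strictly_convex_length_bounded[OF blocks_bounded[OF hereditary_strictly_convex conv] omits sub _ i] D by simp
    ultimately show ?thesis
      unfolding length_bounded_def by (meson le_trans)
  qed
  moreover have "n ^ Suc s = n * D"
    by (simp add: D_def)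
  ultimately show ?case
    unfolding s_def[symmetric] S_def by metis
qed

section \<open>From length bounds to \<open>R\<close> and \<open>C\<close>, and the partition of
  \<open>{1..N}\<close>\<close>

text \<open>The bound itself makes the set of sizes finite, and the empty subset makes it nonempty,
  so \<open>Max\<close> is a genuine maximum.\<close>

lemma R_le:
  assumes "length_bounded (L_regular L) k B"
  shows "R L B \<le> k"
proof -
  let ?cards = "{card B' | B'. B' \<subseteq> B \<and> finite B' \<and> L_regular L (sorted_list_of_set B')}"
  have "card B' \<le> k" if "B' \<subseteq> B" "finite B'" "L_regular L (sorted_list_of_set B')" for B'
    using length_boundedD[OF assms that(3)] that by simp
  then have le: "\<forall>m\<in>?cards. m \<le> k"
    by blast
  then have "finite ?cards"
    by (meson finite_nat_set_iff_bounded_le)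
  moreover have "L_regular L (sorted_list_of_set {})"
    by (auto simp: L_regular_def differences_def intro: exI[of _ 1])
  then have "card ({} :: real set) \<in> ?cards"
    by (intro CollectI exI[of _ "{}"]) simp
  ultimately show ?thesis
    unfolding R_def using le by (subst Max_le_iff) blast+
qed

lemma C_le:
  assumes "length_bounded strictly_convex k B"
  shows "C B \<le> k"
proof -
  have le: "\<forall>m\<in>{length xs | xs. set xs \<subseteq> B \<and> strictly_convex xs}. m \<le> k"
    using assms by (auto simp: length_bounded_def)
  then have "finite {length xs | xs. set xs \<subseteq> B \<and> strictly_convex xs}"
    by (meson finite_nat_set_iff_bounded_le)
  moreover have "strictly_convex []"
    by (simp add: strictly_convex_def differences_def)
  then have "length [] \<in> {length xs | xs. set xs \<subseteq> B \<and> strictly_convex xs}"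
    by fastforce
  ultimately show ?thesis
    unfolding C_def using le by (subst Max_le_iff) blast+
qed

theorem theorem5:
  fixes r :: nat
  assumes "r \<ge> 1"
  shows "\<forall>M::nat. \<exists>N::nat. N \<ge> M \<and>
    (\<exists>A :: nat \<Rightarrow> real set.
       (\<Union>i\<in>{1..r}. A i) = real ` {1..N} \<and>
       disjoint_family_on A {1..r} \<and>
       (\<forall>i\<in>{1..r}. A i \<noteq> {}) \<and>
       real (Max ((\<lambda>i. R 2 (A i)) ` {1..r})) \<le> 2 * fact (r - 1) * real N powr (1 / real r) \<and>
       real (Max ((\<lambda>i. C (A i)) ` {1..r})) \<le> fact r * real N powr (1 / real r))"
proof
  fix M :: nat
  \<comment> \<open>The summand 2 secures \<open>n \<ge> 2\<close> for the colouring, and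
    \<open>n ^ r \<ge> n\<close> then exceeds \<open>M\<close>.\<close>
  define n where "n = M + 2"
  define N where "N = n ^ r"
  obtain s where s: "r = Suc s"
    using assms by (cases r) auto
  obtain f where f: "\<And>p. p < N \<Longrightarrow> f p < r"
    and ne: "\<And>i. i < r \<Longrightarrow> colour_class N f i \<noteq> {}"
    and reg: "\<And>i. i < r \<Longrightarrow> length_bounded (L_regular 2) (2 * fact (r - 1) * n) (colour_class N f i)"
    and conv: "\<And>i. i < r \<Longrightarrow> length_bounded strictly_convex (fact r * n) (colour_class N f i)"
    using ex_colouring[of n s] unfolding N_def s n_def by auto
  \<comment> \<open>Shifts both the points, from \<open>{0..<N}\<close> to \<open>{1..N}\<close>,
    and the colours, from \<open>{0..<r}\<close> to \<open>{1..r}\<close>; length bounds are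
    invariant under translation.\<close>
  define A where "A i = (\<lambda>x. x + 1) ` colour_class N f (i - 1)" for i
  have root: "real N powr (1 / real r) = real n"
    using assms by (simp add: N_def n_def powr_powr flip: powr_realpow)
  have "M \<le> N"
    using self_le_power[of n r] assms by (simp add: N_def n_def)
  moreover have "(\<Union>i\<in>{1..r}. A i) = real ` {1..N}"
  proof
    show "(\<Union>i\<in>{1..r}. A i) \<subseteq> real ` {1..N}"
    proof
      fix x assume "x \<in> (\<Union>i\<in>{1..r}. A i)"
      then obtain p where "p < N" "x = real (Suc p)"
        by (auto simp: A_def colour_class_def)
      then show "x \<in> real ` {1..N}" by (intro image_eqI[of _ _ "Suc p"]) auto
    qed
    show "real ` {1..N} \<subseteq> (\<Union>i\<in>{1..r}. A i)"
    proof
      fix x assume "x \<in> real ` {1..N}"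
      then obtain p where p: "1 \<le> p" "p \<le> N" "x = real p"
        by auto
      then have "x = real (p - 1) + 1" "p - 1 < N"
        by auto
      then have "x \<in> A (Suc (f (p - 1)))" "Suc (f (p - 1)) \<in> {1..r}"
        using f[of "p - 1"] by (auto simp: A_def colour_class_def)
      then show "x \<in> (\<Union>i\<in>{1..r}. A i)" by blast
    qed
  qed
  moreover have "disjoint_family_on A {1..r}"
    by (auto simp: disjoint_family_on_def A_def colour_class_def)
  moreover have "\<forall>i\<in>{1..r}. A i \<noteq> {}"
    using ne by (auto simp: A_def)
  moreover have "real (Max ((\<lambda>i. R 2 (A i)) ` {1..r})) \<le> 2 * fact (r - 1) * real n"
  proof -
    have "R 2 (A i) \<le> 2 * fact (r - 1) * n" if "i \<in> {1..r}" for i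
      using that unfolding A_def
      by (intro R_le length_bounded_translate hereditary_L_regular reg) auto
    then have "Max ((\<lambda>i. R 2 (A i)) ` {1..r}) \<le> 2 * fact (r - 1) * n"
      using assms by (subst Max_le_iff) auto
    from of_nat_mono[OF this, where 'a = real] show ?thesis
      by simp
  qed
  moreover have "real (Max ((\<lambda>i. C (A i)) ` {1..r})) \<le> fact r * real n"
  proof -
    have "C (A i) \<le> fact r * n" if "i \<in> {1..r}" for i
      using that unfolding A_def
      by (intro C_le length_bounded_translate hereditary_strictly_convex conv) auto
    then have "Max ((\<lambda>i. C (A i)) ` {1..r}) \<le> fact r * n"
      using assms by (subst Max_le_iff) auto
    from of_nat_mono[OF this, where 'a = real] show ?thesis
      by simp
  qed
  ultimately show "\<exists>N::nat. N \<ge> M \<and>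
    (\<exists>A :: nat \<Rightarrow> real set.
       (\<Union>i\<in>{1..r}. A i) = real ` {1..N} \<and>
       disjoint_family_on A {1..r} \<and>
       (\<forall>i\<in>{1..r}. A i \<noteq> {}) \<and>
       real (Max ((\<lambda>i. R 2 (A i)) ` {1..r})) \<le> 2 * fact (r - 1) * real N powr (1 / real r) \<and>
       real (Max ((\<lambda>i. C (A i)) ` {1..r})) \<le> fact r * real N powr (1 / real r))"
    by (intro exI[of _ N] exI[of _ A] conjI) (assumption | simp only: root)+
qed

end
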